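(* Let $(X,\beta)$ be a finite labelled Markov chain with labels in the finite set $A$, let $(M,d)$ be a nonempty complete metric space and $\sigma:A\to\operatorname{Con}(M,d)$ a contraction operator interpretation. Then the map $\hat\beta_\sigma:X\to\mathbf P(M,d)$ is the unique solution to $(X,\beta)$.
   Context: $\mathcal D(S)$ denotes finitely supported probability distributions on a set $S$. A labelled Markov chain (LMC) is $(X,\beta)$ with $\beta:X\to\mathcal D(A\times X)$; write $x\xrightarrow{r\mid a}y$ when $\beta(x)(a,y)=r$ (and $r>0$ in sums below). $A^\omega$ (streams over $A$) carries the topology with basic open sets $B_w=\{(a_1,\dots,a_n,b_1,b_2,\dots)\}$ for $w=a_1\cdots a_n\in A^*$. For $x\in X$, $\hat\beta(x)$ is the unique Borel probability measure on $A^\omega$ with $\hat\beta(x)(B_{a_1\cdots a_n})=\sum\{r_1\cdots r_n : x\xrightarrow{r_1\mid a_1}x_1\cdots\xrightarrow{r_n\mid a_n}x_n\}$ (and $\hat\beta(x)(B_\epsilon)=1$). $\operatorname{Con}(M,d)$: contractions on $M$; $\sigma_a=\sigma(a)$; $\sigma_\omega:A^\omega\to M$, $\sigma_\omega(a_1,\dots)=\lim_n\sigma_{a_1}\cdots\sigma_{a_n}(p)$ ($p$ arbitrary). $\mathbf P(M,d)$ is the set of Borel probability measures on $M$; for continuous $g$, the pushforward is $g^\#\rho(B)=\rho(g^{-1}(B))$. The regular subfractal measure is $\hat\beta_\sigma(x)=\sigma_\omega^\#\hat\beta(x)$. A solution to $(X,\beta)$ is $\varphi:X\to\mathbf P(M,d)$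 such that for all $x\in X$ and Borel $B\subseteq M$, $\varphi(x)(B)=\sum_{x\xrightarrow{r\mid a}y} r\,\sigma_a^\#(\varphi(y))(B)$. *)

theory Defs
  imports "HOL-Probability.Probability" "HOL-Library.Stream"
begin

section \<open>Labelled Markov chains\<close>

text \<open>
  The state space and the alphabet are finite types, so every probability mass function on
  \<open>A \<times> X\<close> is finitely supported; \<open>x \<rightarrow> y\<close> with label \<open>r | a\<close> and \<open>r > 0\<close> holds
  iff \<open>(a, y) \<in> set_pmf (\<beta> x)\<close> and \<open>r = pmf (\<beta> x) (a, y)\<close>.
\<close>

type_synonym ('x, 'a) lmc = "'x \<Rightarrow> ('a \<times> 'x) pmf"

text \<open>
  The list \<open>xs\<close> holds the states \<open>x\<^sub>1, \<dots>, x\<^sub>n\<close> visited after the initial state,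
  so the i-th step (counting from 0) goes from \<open>(x # xs) ! i\<close> to \<open>xs ! i\<close>.
\<close>

definition paths :: "('x, 'a) lmc \<Rightarrow> 'x \<Rightarrow> 'a list \<Rightarrow> 'x list set" where
  "paths \<beta> x w =
     {xs. length xs = length w \<and>
          (\<forall>i<length w. (w ! i, xs ! i) \<in> set_pmf (\<beta> ((x # xs) ! i)))}"

definition word_prob :: "('x::finite, 'a::finite) lmc \<Rightarrow> 'x \<Rightarrow> 'a list \<Rightarrow> real" where
  "word_prob \<beta> x w =
     (\<Sum>xs\<in>paths \<beta> x w. \<Prod>i<length w. pmf (\<beta> ((x # xs) ! i)) (w ! i, xs ! i))"

section \<open>The measure on streams\<close>

definition cylinder :: "'a list \<Rightarrow> 'a stream set" where
  "cylinder w = {w @- s | s. True}"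

definition stream_topology :: "'a stream topology" where
  "stream_topology = topology_generated_by (range cylinder)"

definition stream_borel :: "'a stream measure" where
  "stream_borel = sigma UNIV {U. openin stream_topology U}"

definition lmc_measure :: "('x::finite, 'a::finite) lmc \<Rightarrow> 'x \<Rightarrow> 'a stream measure" where
  "lmc_measure \<beta> x =
     (THE \<mu>. prob_space \<mu> \<and> sets \<mu> = sets stream_borel \<and>
            (\<forall>w. measure \<mu> (cylinder w) = word_prob \<beta> x w))"

section \<open>Contraction operator interpretations and regular subfractal measures\<close>

definition Con :: "('m::metric_space \<Rightarrow> 'm) set" where
  "Con = {f. \<exists>c<1. c-lipschitz_on UNIV f}"

text \<open>
  \<open>foldr \<sigma> [a\<^sub>1, \<dots>, a\<^sub>n] p\<close> is \<open>\<sigma> a\<^sub>1 (\<dots> (\<sigma> a\<^sub>n p))\<close>.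
  The point \<open>p\<close> is arbitrary: the value is the common limit for all starting points.
\<close>

definition stream_point :: "('a \<Rightarrow> 'm::metric_space \<Rightarrow> 'm) \<Rightarrow> 'a stream \<Rightarrow> 'm" where
  "stream_point \<sigma> s = (THE q. \<forall>p. (\<lambda>n. foldr \<sigma> (stake n s) p) \<longlonglongrightarrow> q)"

definition subfractal_measure ::
  "('x::finite, 'a::finite) lmc \<Rightarrow> ('a \<Rightarrow> 'm::metric_space \<Rightarrow> 'm) \<Rightarrow> 'x \<Rightarrow> 'm measure" where
  "subfractal_measure \<beta> \<sigma> x = distr (lmc_measure \<beta> x) borel (stream_point \<sigma>)"

section \<open>Solutions\<close>

definition borel_probs :: "'m::topological_space measure set" where
  "borel_probs = {\<rho>. prob_space \<rho> \<and> sets \<rho> = sets borel}"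

definition is_solution ::
  "('x::finite, 'a::finite) lmc \<Rightarrow> ('a \<Rightarrow> 'm::metric_space \<Rightarrow> 'm) \<Rightarrow> ('x \<Rightarrow> 'm measure) \<Rightarrow> bool"
where
  "is_solution \<beta> \<sigma> \<phi> \<longleftrightarrow>
     (\<forall>x. \<phi> x \<in> borel_probs) \<and>
     (\<forall>x. \<forall>B\<in>sets borel.
        measure (\<phi> x) B =
          (\<Sum>(a, y)\<in>set_pmf (\<beta> x). pmf (\<beta> x) (a, y) * measure (distr (\<phi> y) borel (\<sigma> a)) B))"

end

theory Submission
  imports Defs
begin

text \<open>
  Existence reduces to the one-step decomposition of the measure on streams, because
  \<open>stream_point \<sigma> (a ## s) = \<sigma> a (stream_point \<sigma> s)\<close>. For uniqueness, compactness and
  separability are not available, but a large ball \<open>K\<close> carries all but \<open>\<delta>\<close> of the mass of each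
  of the finitely many measures involved, and long words map \<open>K\<close> to sets of diameter less than
  \<open>\<epsilon>\<close>. Iterating the equation gives \<open>\<phi> x F \<le> \<psi> x (F\<^sub>\<epsilon>) + \<delta>\<close> for the \<open>\<epsilon>\<close>-neighbourhood
  \<open>F\<^sub>\<epsilon>\<close> of a closed set \<open>F\<close>; closed sets form an intersection-stable generator.
\<close>

section \<open>The Borel space of streams\<close>

lemma cylinder_eq_sstart: "cylinder w = sstart UNIV w"
proof (induction w)
  case (Cons a w)
  have "cylinder (a # w) = (##) a ` cylinder w"
    by (auto simp: cylinder_def)
  then show ?case by (simp add: Cons.IH sstart.simps(2))
qed (simp add: cylinder_def)

lemma in_cylinder_iff: "s \<in> cylinder w \<longleftrightarrow> stake (length w) s = w"
proof (induction w arbitrary: s)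
  case (Cons a w)
  then show ?case by (cases s) (auto simp: cylinder_eq_sstart)
qed (simp add: cylinder_def)

text \<open>The cylinders containing \<open>s\<close> are those of its prefixes and hence nested, so
  a finite intersection of them is the one with the longest prefix. The generating family is
  therefore already a base.\<close>

lemma stream_topology_open_contains_cylinder:
  assumes "openin stream_topology U" "s \<in> U"
  shows "\<exists>n. cylinder (stake n s) \<subseteq> U"
proof -
  have "generate_topology_on (range cylinder) U"
    using assms(1) unfolding stream_topology_def by (rule openin_topology_generated_by)
  then show ?thesis using assms(2)
  proof (induction arbitrary: s)
    case (Int U V)
    then obtain m n where "cylinder (stake m s) \<subseteq> U" "cylinder (stake n s) \<subseteq> V"
      by blast
    moreover have "cylinder (stake k s) \<subseteq> cylinder (stake j s)" if "j \<le> k" for j k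
    proof
      fix t assume "t \<in> cylinder (stake k s)"
      then have "stake k t = stake k s" by (simp add: in_cylinder_iff)
      then have "take j (stake k t) = take j (stake k s)" by simp
      then show "t \<in> cylinder (stake j s)"
        using that by (simp add: in_cylinder_iff take_stake min_def split: if_splits)
    qed
    ultimately have "cylinder (stake (max m n) s) \<subseteq> U \<inter> V"
      by (meson Int_greatest max.cobounded1 max.cobounded2 order_trans)
    then show ?case ..
  next
    case (UN K)
    then show ?case by (meson Union_iff Union_upper order_trans)
  next
    case (Basis U)
    then obtain w where "U = cylinder w" "stake (length w) s = w"
      by (auto simp: in_cylinder_iff)
    then show ?case by (metis order_refl)
  qed simp
qed

text \<open>A countable alphabet has countably many words, so every open set is a countable union of
  cylinders; conversely cylinders generate the product sigma-algebra. This makes the theory of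
  \<open>stream_space\<close> applicable.\<close>

lemma sets_stream_borel:
  "sets (stream_borel :: 'a::countable stream measure) = sets (stream_space (count_space UNIV))"
proof
  have "{U :: 'a stream set. openin stream_topology U} \<subseteq> sets (stream_space (count_space UNIV))"
  proof (intro subsetI, unfold mem_Collect_eq)
    fix U :: "'a stream set" assume U: "openin stream_topology U"
    have "U = \<Union>(cylinder ` {w. cylinder w \<subseteq> U})"
      using stream_topology_open_contains_cylinder[OF U] by (fastforce simp: in_cylinder_iff)
    also have "\<dots> \<in> sets (stream_space (count_space UNIV))"
      by (intro sets.countable_UN') (auto simp: cylinder_eq_sstart)
    finally show "U \<in> sets (stream_space (count_space UNIV))" .
  qed
  from sets.sigma_sets_subset[OF this] have
    "sigma_sets (space (stream_space (count_space UNIV))) {U :: 'a stream set. openin stream_topology U}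
      \<subseteq> sets (stream_space (count_space UNIV))" .
  moreover have "sets (stream_borel :: 'a stream measure)
      = sigma_sets (space (stream_space (count_space UNIV))) {U. openin stream_topology U}"
    by (simp add: stream_borel_def space_stream_space)
  ultimately show "sets (stream_borel :: 'a stream measure) \<subseteq> sets (stream_space (count_space UNIV))"
    by simp
next
  have "openin stream_topology (cylinder w)" for w :: "'a list"
    unfolding stream_topology_def by (intro topology_generated_by_Basis) simp
  moreover have "openin stream_topology ({} :: 'a stream set)" by simp
  ultimately have
    "sstart UNIV ` lists UNIV \<union> {{}} \<subseteq> {U :: 'a stream set. openin stream_topology U}"
    by (auto simp: cylinder_eq_sstart)
  then show "sets (stream_space (count_space UNIV)) \<subseteq> sets (stream_borel :: 'a stream measure)"
    by (simp add: sets_stream_space_sstart stream_borel_def sigma_sets_mono')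
qed

section \<open>Construction of the measure on streams\<close>

text \<open>
  A step of the chain is an independently drawn random function \<open>f\<close> such that \<open>f x\<close> has
  distribution \<open>\<beta> x\<close> for every state \<open>x\<close>. This reduces the existence of the trace measures to
  that of the countable power of a single probability space.
\<close>

primcorec labels :: "'x \<Rightarrow> ('x \<Rightarrow> 'a \<times> 'x) stream \<Rightarrow> 'a stream" where
  "shd (labels x \<omega>) = fst (shd \<omega> x)"
| "stl (labels x \<omega>) = labels (snd (shd \<omega> x)) (stl \<omega>)"

definition steps :: "('x::finite, 'a::finite) lmc \<Rightarrow> ('x \<Rightarrow> 'a \<times> 'x) pmf" where
  "steps \<beta> = Pi_pmf UNIV undefined \<beta>"

definition traces :: "('x::finite, 'a::finite) lmc \<Rightarrow> 'x \<Rightarrow> 'a stream measure" where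
  "traces \<beta> x = distr (stream_space (steps \<beta>)) (stream_space (count_space UNIV)) (labels x)"

lemma labels_Stream: "labels x (f ## \<omega>) = fst (f x) ## labels (snd (f x)) \<omega>"
  by (rule stream.expand) simp

lemma measurable_labels [measurable]:
  fixes x :: "'x::finite"
  shows "labels x \<in> stream_space (count_space (UNIV :: ('x \<Rightarrow> 'a::finite \<times> 'x) set)) \<rightarrow>\<^sub>M
    stream_space (count_space UNIV)"
proof (rule measurable_stream_space2)
  fix n
  show "(\<lambda>\<omega>. labels x \<omega> !! n) \<in>
      stream_space (count_space (UNIV :: ('x \<Rightarrow> 'a \<times> 'x) set)) \<rightarrow>\<^sub>M count_space UNIV"
  proof (induction n arbitrary: x)
    case 0
    show ?case
      by simp (rule measurable_compose[OF measurable_shd, where g = "\<lambda>f. fst (f x)"], simp)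
  next
    case (Suc n)
    \<comment> \<open>The tail is read from the random state \<open>snd (f x)\<close>. Fixing the
      first function \<open>f\<close>, which has only finitely many possible values, makes that
      state constant.\<close>
    have "(\<lambda>\<omega>. labels (snd (f x)) (stl \<omega>) !! n) \<in>
        stream_space (count_space (UNIV :: ('x \<Rightarrow> 'a \<times> 'x) set)) \<rightarrow>\<^sub>M count_space UNIV"
      for f :: "'x \<Rightarrow> 'a \<times> 'x"
      by (rule measurable_compose[OF measurable_stl Suc.IH])
    from measurable_compose_countable[OF this measurable_shd] show ?case
      by simp
  qed
qed

lemma sets_stream_space_measure_pmf:
  "sets (stream_space (measure_pmf p)) = sets (stream_space (count_space UNIV))"
  by (intro sets_stream_space_cong) simp

lemma sets_traces [simp, measurable_cong]:
  "sets (traces \<beta> x) = sets (stream_space (count_space UNIV))"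
  by (simp add: traces_def)

lemma prob_space_traces: "prob_space (traces \<beta> x)"
proof -
  interpret S: prob_space "stream_space (steps \<beta>)"
    by (rule prob_space.prob_space_stream_space) (rule measure_pmf.prob_space_axioms)
  show ?thesis
    unfolding traces_def
    by (rule S.prob_space_distr)
      (simp cong: measurable_cong_sets add: sets_stream_space_measure_pmf)
qed

text \<open>The functions after the first are independent of it and again form an i.i.d. stream, so
  given \<open>f x = (a, y)\<close> the remaining labels are distributed as
  \<open>traces \<beta> y\<close>. Both the cylinder probabilities and the solution equation rest on
  this.\<close>

lemma measure_traces_Stream:
  assumes B [measurable]: "B \<in> sets (stream_space (count_space UNIV))"
  shows "measure (traces \<beta> x) B =
    (\<Sum>(a, y)\<in>set_pmf (\<beta> x). pmf (\<beta> x) (a, y) * measure (traces \<beta> y) {s. a ## s \<in> B})"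
proof -
  define S where "S = stream_space (measure_pmf (steps \<beta>))"
  interpret S: prob_space S
    unfolding S_def
    by (intro prob_space.prob_space_stream_space measure_pmf.prob_space_axioms)
  have sets_S [measurable_cong]: "sets S = sets (stream_space (count_space UNIV))"
    unfolding S_def by (rule sets_stream_space_measure_pmf)
  have space_S [simp]: "space S = UNIV"
    by (simp add: S_def space_stream_space)
  have tail [measurable]: "{s. a ## s \<in> B} \<in> sets (stream_space (count_space UNIV))" for a
  proof -
    have "(\<lambda>s. a ## s) -` B \<inter> space (stream_space (count_space UNIV))
        \<in> sets (stream_space (count_space UNIV))"
      by measurable
    then show ?thesis by (simp add: vimage_def space_stream_space)
  qed
  have tr: "emeasure (traces \<beta> y) C = emeasure S {\<omega>. labels y \<omega> \<in> C}"
    if "C \<in> sets (stream_space (count_space UNIV))" for y C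
    unfolding traces_def S_def[symmetric] using that
    by (subst emeasure_distr) (auto simp: vimage_def)
  have [measurable]: "{\<omega>. labels x \<omega> \<in> B} \<in> sets S"
  proof -
    have "labels x -` B \<inter> space S \<in> sets S" by measurable
    then show ?thesis by (simp add: vimage_def)
  qed
  have "emeasure (traces \<beta> x) B = emeasure S {\<omega>. labels x \<omega> \<in> B}"
    by (rule tr[OF B])
  \<comment> \<open>The law of an i.i.d. stream is the product of the law of its head with
    itself.\<close>
  also have "\<dots> = (\<integral>\<^sup>+f. emeasure S {\<omega>. labels x (f ## \<omega>) \<in> B} \<partial>steps \<beta>)"
    using prob_space.emeasure_stream_space[OF measure_pmf.prob_space_axioms,
        of "{\<omega>. labels x \<omega> \<in> B}" "steps \<beta>"]
    by (simp flip: S_def)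
  also have "\<dots> = (\<integral>\<^sup>+f. (case f x of (a, y) \<Rightarrow> emeasure (traces \<beta> y) {s. a ## s \<in> B}) \<partial>steps \<beta>)"
    by (intro nn_integral_cong) (simp add: labels_Stream tr split: prod.split)
  \<comment> \<open>The integrand sees \<open>f\<close> only through \<open>f x\<close>, so the
    integral passes to that marginal.\<close>
  also have "\<dots> = (\<integral>\<^sup>+(a, y). emeasure (traces \<beta> y) {s. a ## s \<in> B}
      \<partial>map_pmf (\<lambda>f. f x) (steps \<beta>))"
    by simp
  also have "map_pmf (\<lambda>f. f x) (steps \<beta>) = \<beta> x"
    by (simp add: steps_def Pi_pmf_component)
  also have "(\<integral>\<^sup>+(a, y). emeasure (traces \<beta> y) {s. a ## s \<in> B} \<partial>\<beta> x) =
      (\<Sum>(a, y)\<in>set_pmf (\<beta> x). emeasure (traces \<beta> y) {s. a ## s \<in> B} * pmf (\<beta> x) (a, y))"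
    by (subst nn_integral_measure_pmf_finite) (auto simp: case_prod_unfold)
  also have "\<dots> = ennreal
      (\<Sum>(a, y)\<in>set_pmf (\<beta> x). pmf (\<beta> x) (a, y) * measure (traces \<beta> y) {s. a ## s \<in> B})"
    by (subst sum_ennreal[symmetric])
      (auto simp: case_prod_unfold ennreal_mult mult.commute prob_space_traces
        finite_measure.emeasure_eq_measure prob_space.finite_measure intro!: sum.cong)
  finally show ?thesis
    by (simp add: finite_measure.emeasure_eq_measure prob_space.finite_measure
        prob_space_traces sum_nonneg case_prod_unfold)
qed

section \<open>Path sums and identification of the stream measure\<close>

lemma paths_Cons:
  "paths \<beta> x (a # w) = (\<Union>y\<in>{y. (a, y) \<in> set_pmf (\<beta> x)}. (#) y ` paths \<beta> y w)"
proof -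
  have "xs \<in> paths \<beta> x (a # w) \<longleftrightarrow>
      (\<exists>y ys. xs = y # ys \<and> (a, y) \<in> set_pmf (\<beta> x) \<and> ys \<in> paths \<beta> y w)" for xs
    by (cases xs) (auto simp: paths_def All_less_Suc2)
  then show ?thesis by blast
qed

lemma finite_paths: "finite (paths \<beta> (x :: 'x::finite) w)"
  by (rule finite_subset[OF _ finite_lists_length_eq[of "UNIV :: 'x set" "length w"]])
    (auto simp: paths_def)

text \<open>Paths are grouped by the first state they visit; the groups are disjoint. The result is
  the recursion that \<open>traces\<close> satisfies on cylinders.\<close>

lemma word_prob_Cons:
  "word_prob \<beta> x (a # w) =
    (\<Sum>y | (a, y) \<in> set_pmf (\<beta> x). pmf (\<beta> x) (a, y) * word_prob \<beta> y w)"
proof -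
  have "word_prob \<beta> x (a # w) = (\<Sum>y | (a, y) \<in> set_pmf (\<beta> x). \<Sum>xs\<in>(#) y ` paths \<beta> y w.
      \<Prod>i<length (a # w). pmf (\<beta> ((x # xs) ! i)) ((a # w) ! i, xs ! i))"
    unfolding word_prob_def paths_Cons
    by (intro sum.UNION_disjoint) (auto simp: finite_paths)
  also have "\<dots> = (\<Sum>y | (a, y) \<in> set_pmf (\<beta> x). pmf (\<beta> x) (a, y) * word_prob \<beta> y w)"
    by (intro sum.cong refl)
      (simp add: sum.reindex word_prob_def sum_distrib_left prod.lessThan_Suc_shift
        del: prod.lessThan_Suc)
  finally show ?thesis .
qed

lemma measure_traces_cylinder: "measure (traces \<beta> x) (cylinder w) = word_prob \<beta> x w"
proof (induction w arbitrary: x)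
  case Nil
  have "measure (traces \<beta> x) (space (traces \<beta> x)) = 1"
    by (rule prob_space.prob_space) (rule prob_space_traces)
  moreover have "space (traces \<beta> x) = cylinder []" "paths \<beta> x [] = {[]}"
    by (auto simp: traces_def space_stream_space cylinder_def paths_def)
  ultimately show ?case by (simp add: word_prob_def)
next
  case (Cons a w)
  \<comment> \<open>Removing a first letter \<open>b\<close> from \<open>cylinder (a # w)\<close>
    leaves \<open>cylinder w\<close> if \<open>b = a\<close> and the empty set otherwise.\<close>
  have "measure (traces \<beta> x) (cylinder (a # w)) = (\<Sum>(b, y)\<in>set_pmf (\<beta> x).
      pmf (\<beta> x) (b, y) * (if b = a then word_prob \<beta> y w else 0))"
    by (subst measure_traces_Stream)
      (auto simp: cylinder_eq_sstart simp flip: Cons.IH intro!: sum.cong)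
  also have "\<dots> = (\<Sum>(b, y)\<in>Pair a ` {y. (a, y) \<in> set_pmf (\<beta> x)}.
      pmf (\<beta> x) (b, y) * (if b = a then word_prob \<beta> y w else 0))"
    by (rule sum.mono_neutral_right) auto
  also have "\<dots> = word_prob \<beta> x (a # w)"
    by (simp add: sum.reindex inj_on_def word_prob_Cons)
  finally show ?case .
qed

text \<open>Existence comes from the construction. Uniqueness holds because cylinders, together with
  the empty set, form an intersection-stable generator, so the word probabilities determine the
  measure.\<close>

lemma lmc_measure_eq_traces:
  fixes \<beta> :: "('x::finite, 'a::finite) lmc"
  shows "lmc_measure \<beta> x = traces \<beta> x"
  unfolding lmc_measure_def
proof (rule the_equality)
  show "prob_space (traces \<beta> x) \<and> sets (traces \<beta> x) = sets stream_borel \<and>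
      (\<forall>w. measure (traces \<beta> x) (cylinder w) = word_prob \<beta> x w)"
    by (simp add: prob_space_traces sets_stream_borel measure_traces_cylinder)
next
  fix \<mu> :: "'a stream measure"
  assume \<mu>: "prob_space \<mu> \<and> sets \<mu> = sets stream_borel \<and>
      (\<forall>w. measure \<mu> (cylinder w) = word_prob \<beta> x w)"
  show "\<mu> = traces \<beta> x"
  proof (rule stream_space_eq_sstart[of UNIV])
    show "emeasure \<mu> (sstart UNIV w) = emeasure (traces \<beta> x) (sstart UNIV w)" for w
      using \<mu> measure_traces_cylinder[of \<beta> x w] prob_space_traces[of \<beta> x]
      by (simp add: finite_measure.emeasure_eq_measure prob_space.finite_measure
          flip: cylinder_eq_sstart)
  qed (use \<mu> in \<open>simp_all add: prob_space_traces sets_stream_borel\<close>)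
qed

section \<open>Contractions\<close>

text \<open>The alphabet is finite, so the largest of the individual constants is still below
  1.\<close>

lemma uniform_contraction_constant:
  fixes \<sigma> :: "'a::finite \<Rightarrow> 'm::metric_space \<Rightarrow> 'm"
  assumes "\<And>a. \<sigma> a \<in> Con"
  shows "\<exists>c\<ge>0. c < 1 \<and> (\<forall>a. c-lipschitz_on UNIV (\<sigma> a))"
proof -
  have "\<forall>a. \<exists>k. k < 1 \<and> k-lipschitz_on UNIV (\<sigma> a)"
    using assms by (auto simp: Con_def)
  from choice[OF this] obtain k
    where k: "\<And>a. k a < 1" "\<And>a. (k a)-lipschitz_on UNIV (\<sigma> a)"
    by blast
  have lip: "(Max (range k))-lipschitz_on UNIV (\<sigma> a)" for a
    by (rule lipschitz_on_le[OF k(2)]) simp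
  moreover have "Max (range k) < 1" using k(1) by simp
  ultimately show ?thesis using lipschitz_on_nonneg[OF lip] by blast
qed

lemma lipschitz_on_foldr:
  assumes "\<And>a. c-lipschitz_on UNIV (\<sigma> a)"
  shows "(c ^ length w)-lipschitz_on UNIV (foldr \<sigma> w)"
proof (induction w)
  case Nil
  show ?case by (simp add: lipschitz_on_def)
next
  case (Cons a w)
  have "(c * c ^ length w)-lipschitz_on UNIV (\<sigma> a \<circ> foldr \<sigma> w)"
    using Cons.IH assms by (intro lipschitz_on_compose) (auto intro: lipschitz_on_subset)
  then show ?case by (simp add: o_def)
qed

text \<open>Orbits of a fixed point under all words stay in a bounded set, and the maps of the first
  \<open>n\<close> letters shrink that set by \<open>c ^ n\<close>; hence the sequence is
  Cauchy.\<close>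

lemma stream_point_exists:
  fixes \<sigma> :: "'a::finite \<Rightarrow> 'm::complete_space \<Rightarrow> 'm"
  assumes "\<And>a. \<sigma> a \<in> Con"
  shows "\<exists>q. \<forall>p. (\<lambda>n. foldr \<sigma> (stake n s) p) \<longlonglongrightarrow> q"
proof -
  obtain c where c: "0 \<le> c" "c < 1" "\<And>a. c-lipschitz_on UNIV (\<sigma> a)"
    using uniform_contraction_constant[of \<sigma>] assms by blast
  have lip: "dist (foldr \<sigma> (stake n s) p) (foldr \<sigma> (stake n s) q) \<le> c ^ n * dist p q" for n p q
    using lipschitz_onD[OF lipschitz_on_foldr[OF c(3), of "stake n s"], of p q] by simp
  \<comment> \<open>Types are inhabited; this is where nonemptiness of the space enters.\<close>
  fix p\<^sub>0 :: 'm
  define X where "X n = foldr \<sigma> (stake n s) p\<^sub>0" for n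
  define D where "D = Max (range (\<lambda>a. dist p\<^sub>0 (\<sigma> a p\<^sub>0)))"
  \<comment> \<open>With \<open>D\<close> the largest displacement of \<open>p\<^sub>0\<close> by
    one letter, prepending a letter turns a bound \<open>t\<close> into \<open>D + c * t\<close>;
    the fixed point of this map is \<open>D / (1 - c)\<close>.\<close>
  have orbit: "dist p\<^sub>0 (foldr \<sigma> w p\<^sub>0) \<le> D / (1 - c)" for w
  proof (induction w)
    case Nil
    have "0 \<le> dist p\<^sub>0 (\<sigma> undefined p\<^sub>0)" by simp
    also have "\<dots> \<le> D" by (simp add: D_def)
    finally show ?case using c(2) by simp
  next
    case (Cons a w)
    have "dist p\<^sub>0 (\<sigma> a p\<^sub>0) \<le> D" by (simp add: D_def)
    moreover have "dist (\<sigma> a p\<^sub>0) (\<sigma> a (foldr \<sigma> w p\<^sub>0)) \<le> c * (D / (1 - c))"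
      using lipschitz_onD[OF c(3), of p\<^sub>0 "foldr \<sigma> w p\<^sub>0" a] mult_left_mono[OF Cons.IH c(1)]
      by simp
    moreover have "D + c * (D / (1 - c)) = D / (1 - c)"
      using c(2) by (simp add: field_simps)
    ultimately show ?case
      using dist_triangle[of p\<^sub>0 "\<sigma> a (foldr \<sigma> w p\<^sub>0)" "\<sigma> a p\<^sub>0"] by simp
  qed
  have "Cauchy X"
    unfolding Cauchy_altdef2
  proof (intro allI impI)
    fix e :: real assume "e > 0"
    have "(\<lambda>n. c ^ n * (D / (1 - c))) \<longlonglongrightarrow> 0"
      using c by (intro tendsto_mult_left_zero LIMSEQ_power_zero) auto
    from eventually_happens'[OF _ order_tendstoD(2)[OF this \<open>e > 0\<close>]]
    obtain n where n: "c ^ n * (D / (1 - c)) < e" by auto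
    have "dist (X m) (X n) < e" if "m \<ge> n" for m
    proof -
      \<comment> \<open>Later letters act innermost, so lengthening the word only changes the point
        to which the first \<open>n\<close> maps are applied.\<close>
      have "X m = foldr \<sigma> (stake n s) (foldr \<sigma> (stake (m - n) (sdrop n s)) p\<^sub>0)"
        using that stake_add[of n s "m - n"] by (simp add: X_def flip: foldr_append)
      then have "dist (X n) (X m) \<le> c ^ n * dist p\<^sub>0 (foldr \<sigma> (stake (m - n) (sdrop n s)) p\<^sub>0)"
        using lip by (simp add: X_def)
      also have "\<dots> \<le> c ^ n * (D / (1 - c))"
        using c(1) by (intro mult_left_mono orbit) simp
      finally show ?thesis using n by (simp add: dist_commute)
    qed
    then show "\<exists>n. \<forall>m\<ge>n. dist (X m) (X n) < e" by blast
  qed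
  then obtain q where q: "X \<longlonglongrightarrow> q"
    using Cauchy_convergent convergent_def by blast
  \<comment> \<open>Two starting points are \<open>c ^ n * dist p p\<^sub>0\<close> apart at most
    after \<open>n\<close> letters, so the limit is shared.\<close>
  have "(\<lambda>n. foldr \<sigma> (stake n s) p) \<longlonglongrightarrow> q" for p
    unfolding tendsto_dist_iff[of _ q]
  proof (rule tendsto_sandwich[OF always_eventually always_eventually tendsto_const])
    have "(\<lambda>n. c ^ n * dist p p\<^sub>0) \<longlonglongrightarrow> 0"
      using c by (intro tendsto_mult_left_zero LIMSEQ_power_zero) auto
    then show "(\<lambda>n. c ^ n * dist p p\<^sub>0 + dist (X n) q) \<longlonglongrightarrow> 0"
      using q by (intro tendsto_add_zero) (simp_all add: tendsto_dist_iff[of _ q])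
    show "\<forall>n. dist (foldr \<sigma> (stake n s) p) q \<le> c ^ n * dist p p\<^sub>0 + dist (X n) q"
    proof
      fix n
      show "dist (foldr \<sigma> (stake n s) p) q \<le> c ^ n * dist p p\<^sub>0 + dist (X n) q"
        using lip[of n p p\<^sub>0] dist_triangle[of "foldr \<sigma> (stake n s) p" q "X n"]
        unfolding X_def by linarith
    qed
  qed simp
  then show ?thesis by blast
qed

section \<open>The limit map on streams and existence of a solution\<close>

lemma stream_point_LIMSEQ:
  fixes \<sigma> :: "'a::finite \<Rightarrow> 'm::complete_space \<Rightarrow> 'm"
  assumes "\<And>a. \<sigma> a \<in> Con"
  shows "(\<lambda>n. foldr \<sigma> (stake n s) p) \<longlonglongrightarrow> stream_point \<sigma> s"
proof -
  have "\<exists>!q. \<forall>p. (\<lambda>n. foldr \<sigma> (stake n s) p) \<longlonglongrightarrow> q"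
  proof (rule ex_ex1I)
    show "\<exists>q. \<forall>p. (\<lambda>n. foldr \<sigma> (stake n s) p) \<longlonglongrightarrow> q"
      using assms by (rule stream_point_exists)
  qed (blast intro: LIMSEQ_unique)
  from theI'[OF this] show ?thesis
    unfolding stream_point_def by blast
qed

lemma continuous_on_Con: "f \<in> Con \<Longrightarrow> continuous_on UNIV f"
  unfolding Con_def by (auto intro: lipschitz_on_continuous_on)

text \<open>The prefix of length \<open>Suc n\<close> of \<open>a ## s\<close> is \<open>a\<close>
  followed by the prefix of length \<open>n\<close> of \<open>s\<close>, and the continuous
  \<open>\<sigma> a\<close> commutes with the limit.\<close>

lemma stream_point_Stream:
  fixes \<sigma> :: "'a::finite \<Rightarrow> 'm::complete_space \<Rightarrow> 'm"
  assumes "\<And>a. \<sigma> a \<in> Con"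
  shows "stream_point \<sigma> (a ## s) = \<sigma> a (stream_point \<sigma> s)"
proof (rule LIMSEQ_unique)
  fix p
  show "(\<lambda>n. foldr \<sigma> (stake (Suc n) (a ## s)) p) \<longlonglongrightarrow> stream_point \<sigma> (a ## s)"
    using stream_point_LIMSEQ[OF assms] by (rule LIMSEQ_Suc)
  show "(\<lambda>n. foldr \<sigma> (stake (Suc n) (a ## s)) p) \<longlonglongrightarrow> \<sigma> a (stream_point \<sigma> s)"
    using continuous_on_tendsto_compose[OF continuous_on_Con[OF assms]
        stream_point_LIMSEQ[OF assms]]
    by simp
qed

text \<open>A pointwise limit of maps that depend on finitely many letters only.\<close>

lemma measurable_stream_point [measurable]:
  fixes \<sigma> :: "'a::finite \<Rightarrow> 'm::complete_space \<Rightarrow> 'm"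
  assumes "\<And>a. \<sigma> a \<in> Con"
  shows "stream_point \<sigma> \<in> stream_space (count_space UNIV) \<rightarrow>\<^sub>M borel"
proof (rule borel_measurable_LIMSEQ_metric)
  fix p
  show "(\<lambda>s. foldr \<sigma> (stake n s) p) \<in> stream_space (count_space UNIV) \<rightarrow>\<^sub>M borel" for n
    by (rule measurable_compose[OF measurable_stake]) simp
  show "(\<lambda>n. foldr \<sigma> (stake n s) p) \<longlonglongrightarrow> stream_point \<sigma> s" for s
    by (rule stream_point_LIMSEQ[OF assms])
qed

lemma is_solution_subfractal_measure:
  fixes \<beta> :: "('x::finite, 'a::finite) lmc"
    and \<sigma> :: "'a \<Rightarrow> 'm::complete_space \<Rightarrow> 'm"
  assumes \<sigma>: "\<And>a. \<sigma> a \<in> Con"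
  shows "is_solution \<beta> \<sigma> (subfractal_measure \<beta> \<sigma>)"
  unfolding is_solution_def
proof (intro conjI allI ballI)
  note [measurable] = measurable_stream_point[OF \<sigma>]
  fix x
  show "subfractal_measure \<beta> \<sigma> x \<in> borel_probs"
    by (simp add: borel_probs_def subfractal_measure_def lmc_measure_eq_traces
        prob_space.prob_space_distr[OF prob_space_traces])
  fix B :: "'m set" assume B [measurable]: "B \<in> sets borel"
  have [measurable]: "\<sigma> a \<in> borel \<rightarrow>\<^sub>M borel" for a
    by (rule borel_measurable_continuous_onI[OF continuous_on_Con[OF \<sigma>]])
  have space: "space (traces \<beta> y) = UNIV" for y
    by (simp add: traces_def space_stream_space)
  have sub: "measure (subfractal_measure \<beta> \<sigma> y) C = measure (traces \<beta> y) (stream_point \<sigma> -` C)"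
    if "C \<in> sets borel" for y C
    using that by (simp add: subfractal_measure_def lmc_measure_eq_traces measure_distr space)
  have pre: "\<sigma> a -` B \<in> sets borel" for a
    using measurable_sets_borel[of "\<sigma> a" borel B] by simp
  have "stream_point \<sigma> -` B \<inter> space (stream_space (count_space UNIV))
      \<in> sets (stream_space (count_space UNIV))"
    by measurable
  then have "measure (subfractal_measure \<beta> \<sigma> x) B = (\<Sum>(a, y)\<in>set_pmf (\<beta> x).
      pmf (\<beta> x) (a, y) * measure (traces \<beta> y) {s. a ## s \<in> stream_point \<sigma> -` B})"
    unfolding sub[OF B] by (intro measure_traces_Stream) (simp add: space_stream_space)
  also have "\<dots> = (\<Sum>(a, y)\<in>set_pmf (\<beta> x).
      pmf (\<beta> x) (a, y) * measure (distr (subfractal_measure \<beta> \<sigma> y) borel (\<sigma> a)) B)"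
  proof -
    \<comment> \<open>Both sides measure the set of streams whose point is sent into
      \<open>B\<close> by \<open>\<sigma> a\<close>.\<close>
    have "measure (distr (subfractal_measure \<beta> \<sigma> y) borel (\<sigma> a)) B
        = measure (traces \<beta> y) {s. a ## s \<in> stream_point \<sigma> -` B}" for a y
    proof -
      have "measure (distr (subfractal_measure \<beta> \<sigma> y) borel (\<sigma> a)) B
          = measure (subfractal_measure \<beta> \<sigma> y) (\<sigma> a -` B)"
        by (subst measure_distr) (auto simp: subfractal_measure_def)
      then show ?thesis
        by (simp only: sub[OF pre]) (simp add: stream_point_Stream[OF \<sigma>] vimage_def)
    qed
    then show ?thesis by simp
  qed
  finally show "measure (subfractal_measure \<beta> \<sigma> x) B = \<dots>" .
qed

section \<open>Uniqueness\<close>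

text \<open>
  If all words of length \<open>n\<close> send the set \<open>K\<close>, which carries almost all mass, either off
  \<open>F\<close> or into \<open>G\<close>, then the iterated equation lets the mass of \<open>F\<close> exceed that of \<open>G\<close>
  by at most the mass outside \<open>K\<close>.
\<close>

lemma solution_le_solution_plus:
  fixes \<beta> :: "('x::finite, 'a::finite) lmc"
    and \<sigma> :: "'a \<Rightarrow> 'm::metric_space \<Rightarrow> 'm"
  assumes \<sigma>: "\<And>a. \<sigma> a \<in> borel \<rightarrow>\<^sub>M borel"
    and sol: "is_solution \<beta> \<sigma> \<phi>" "is_solution \<beta> \<sigma> \<psi>"
    and K: "K \<in> sets borel" "\<And>y. measure (\<phi> y) K \<ge> 1 - \<delta>" "\<And>y. measure (\<psi> y) K \<ge> 1 - \<delta>"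
    and "F \<in> sets borel" "G \<in> sets borel"
    and "\<And>w p q. length w = n \<Longrightarrow> p \<in> K \<Longrightarrow> q \<in> K \<Longrightarrow> foldr \<sigma> w p \<in> F \<Longrightarrow> foldr \<sigma> w q \<in> G"
  shows "measure (\<phi> x) F \<le> measure (\<psi> x) G + \<delta>"
  using assms(7-9)
proof (induction n arbitrary: x F G)
  case 0
  have sets: "sets (\<phi> x) = sets borel" "sets (\<psi> x) = sets borel"
    using sol by (auto simp: is_solution_def borel_probs_def)
  interpret \<phi>: prob_space "\<phi> x"
    using sol(1) by (auto simp: is_solution_def borel_probs_def)
  interpret \<psi>: prob_space "\<psi> x"
    using sol(2) by (auto simp: is_solution_def borel_probs_def)
  show ?case
  \<comment> \<open>Either \<open>F\<close> lies outside \<open>K\<close> and has mass at most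
    \<delta>, or a common point forces \<open>K\<close> into \<open>G\<close> by the hypothesis for
    the empty word.\<close>
  proof (cases "K \<inter> F = {}")
    case True
    then have "measure (\<phi> x) F + measure (\<phi> x) K \<le> 1"
      using 0(1) K(1) \<phi>.prob_le_1[of "F \<union> K"]
      by (subst \<phi>.finite_measure_Union[symmetric]) (auto simp: sets)
    then show ?thesis using K(2)[of x] measure_nonneg[of "\<psi> x" G] by linarith
  next
    case False
    then have "K \<subseteq> G" using 0(3)[of "[]"] by auto
    then have "measure (\<psi> x) K \<le> measure (\<psi> x) G"
      using 0(2) by (intro \<psi>.finite_measure_mono) (auto simp: sets)
    then show ?thesis using K(3)[of x] \<phi>.prob_le_1[of F] by linarith
  qed
next
  case (Suc n)
  have expand: "measure (\<rho> x) B =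
      (\<Sum>(a, y)\<in>set_pmf (\<beta> x). pmf (\<beta> x) (a, y) * measure (\<rho> y) (\<sigma> a -` B))"
    if "is_solution \<beta> \<sigma> \<rho>" "B \<in> sets borel" for \<rho> B
  proof -
    have sets: "sets (\<rho> y) = sets borel" "space (\<rho> y) = UNIV" for y
      using that(1) sets_eq_imp_space_eq[of "\<rho> y" borel]
      by (auto simp: is_solution_def borel_probs_def)
    have "measure (distr (\<rho> y) borel (\<sigma> a)) B = measure (\<rho> y) (\<sigma> a -` B)" for a y
      using \<sigma>[of a] that(2)
      by (subst measure_distr) (auto simp: sets cong: measurable_cong_sets)
    then show ?thesis using that by (simp add: is_solution_def)
  qed
  \<comment> \<open>Pulling \<open>F\<close> and \<open>G\<close> back along
    \<open>\<sigma> a\<close> absorbs the first letter, so the hypothesis for words of length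
    \<open>Suc n\<close> yields the one for length \<open>n\<close>.\<close>
  have "measure (\<phi> y) (\<sigma> a -` F) \<le> measure (\<psi> y) (\<sigma> a -` G) + \<delta>" for a y
  proof (rule Suc.IH)
    show "\<sigma> a -` F \<in> sets borel" "\<sigma> a -` G \<in> sets borel"
      using measurable_sets_borel[OF \<sigma>] Suc.prems(1,2) by auto
    show "foldr \<sigma> w q \<in> \<sigma> a -` G"
      if "length w = n" "p \<in> K" "q \<in> K" "foldr \<sigma> w p \<in> \<sigma> a -` F" for w p q
      using Suc.prems(3)[of "a # w" p q] that by simp
  qed
  then have "measure (\<phi> x) F \<le>
      (\<Sum>(a, y)\<in>set_pmf (\<beta> x). pmf (\<beta> x) (a, y) * (measure (\<psi> y) (\<sigma> a -` G) + \<delta>))"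
    unfolding expand[OF sol(1) Suc.prems(1)]
    by (intro sum_mono) (auto intro!: mult_left_mono)
  \<comment> \<open>The weights sum to 1, so the error \<delta> does not grow with the number of
    steps.\<close>
  also have "\<dots> = measure (\<psi> x) G + (\<Sum>z\<in>set_pmf (\<beta> x). pmf (\<beta> x) z) * \<delta>"
    unfolding expand[OF sol(2) Suc.prems(2)]
    by (simp add: case_prod_unfold distrib_left sum.distrib sum_distrib_right)
  also have "(\<Sum>z\<in>set_pmf (\<beta> x). pmf (\<beta> x) z) = 1"
    by (intro sum_pmf_eq_1) auto
  finally show ?case by simp
qed

text \<open>Balls around \<open>p\<close> exhaust the space. This replaces tightness: bounded sets
  suffice, since contractions shrink every bounded set.\<close>

lemma prob_space_ball_tendsto_1:
  fixes \<rho> :: "'m::metric_space measure"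
  assumes "\<rho> \<in> borel_probs"
  shows "(\<lambda>n. measure \<rho> (ball p (real n))) \<longlonglongrightarrow> 1"
proof -
  interpret prob_space \<rho> using assms by (simp add: borel_probs_def)
  have sets: "sets \<rho> = sets borel" "space \<rho> = UNIV"
    using assms sets_eq_imp_space_eq[of \<rho> borel] by (auto simp: borel_probs_def)
  have "(\<lambda>n. measure \<rho> (ball p (real n))) \<longlonglongrightarrow> measure \<rho> (\<Union>n. ball p (real n))"
    by (intro finite_Lim_measure_incseq) (auto simp: sets incseq_def)
  also have "(\<Union>n. ball p (real n)) = space \<rho>"
    using reals_Archimedean2 by (auto simp: sets)
  finally show ?thesis by (simp add: prob_space)
qed

text \<open>First \<delta> tends to 0 for fixed \<epsilon>, then \<epsilon> tends to 0; a closed set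
  is the intersection of its \<epsilon>-neighbourhoods.\<close>

lemma solution_le_solution:
  fixes \<beta> :: "('x::finite, 'a::finite) lmc"
    and \<sigma> :: "'a \<Rightarrow> 'm::metric_space \<Rightarrow> 'm"
  assumes \<sigma>: "\<And>a. \<sigma> a \<in> Con"
    and sol: "is_solution \<beta> \<sigma> \<phi>" "is_solution \<beta> \<sigma> \<psi>"
    and F: "closed F"
  shows "measure (\<phi> x) F \<le> measure (\<psi> x) F"
proof -
  define N where "N \<epsilon> = (\<Union>q\<in>F. ball q \<epsilon>)" for \<epsilon>
  obtain c where c: "0 \<le> c" "c < 1" "\<And>a. c-lipschitz_on UNIV (\<sigma> a)"
    using uniform_contraction_constant[of \<sigma>] \<sigma> by blast
  fix p\<^sub>0 :: 'm
  have le: "measure (\<phi> x) F \<le> measure (\<psi> x) (N \<epsilon>)" if "\<epsilon> > 0" for \<epsilon>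
  proof (rule field_le_epsilon)
    fix \<delta> :: real assume "\<delta> > 0"
    \<comment> \<open>There are finitely many states, so one radius serves all of them and both
      solutions.\<close>
    have "\<forall>\<^sub>F n in sequentially. \<forall>y\<in>UNIV. measure (\<rho> y) (ball p\<^sub>0 (real n)) > 1 - \<delta>"
      if "is_solution \<beta> \<sigma> \<rho>" for \<rho>
    proof (intro eventually_ball_finite ballI)
      fix y
      have "\<rho> y \<in> borel_probs" using that by (simp add: is_solution_def)
      from order_tendstoD(1)[OF prob_space_ball_tendsto_1[OF this], of "1 - \<delta>"] \<open>\<delta> > 0\<close>
      show "\<forall>\<^sub>F n in sequentially. measure (\<rho> y) (ball p\<^sub>0 (real n)) > 1 - \<delta>" by simp
    qed simp
    from eventually_happens'[OF _ eventually_conj[OF this[OF sol(1)] this[OF sol(2)]]]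
    obtain R :: nat where R: "\<And>y. measure (\<phi> y) (ball p\<^sub>0 R) > 1 - \<delta>"
        "\<And>y. measure (\<psi> y) (ball p\<^sub>0 R) > 1 - \<delta>"
      by auto
    \<comment> \<open>\<open>2 * real R\<close> bounds distances within the ball; the word length
      \<open>n\<close> is chosen after \<open>R\<close>.\<close>
    have "(\<lambda>n. c ^ n * (2 * real R)) \<longlonglongrightarrow> 0"
      using c by (intro tendsto_mult_left_zero LIMSEQ_power_zero) auto
    from eventually_happens'[OF _ order_tendstoD(2)[OF this \<open>\<epsilon> > 0\<close>]]
    obtain n where n: "c ^ n * (2 * real R) < \<epsilon>" by auto
    show "measure (\<phi> x) F \<le> measure (\<psi> x) (N \<epsilon>) + \<delta>"
    proof (rule solution_le_solution_plus[OF _ sol, of "ball p\<^sub>0 R"])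
      show "\<sigma> a \<in> borel \<rightarrow>\<^sub>M borel" for a
        by (rule borel_measurable_continuous_onI[OF continuous_on_Con[OF \<sigma>]])
      show "foldr \<sigma> w q \<in> N \<epsilon>"
        if "length w = n" "p \<in> ball p\<^sub>0 R" "q \<in> ball p\<^sub>0 R" "foldr \<sigma> w p \<in> F" for w p q
      proof -
        have "dist (foldr \<sigma> w p) (foldr \<sigma> w q) \<le> c ^ n * dist p q"
          using lipschitz_onD[OF lipschitz_on_foldr[OF c(3), of w], of p q] that(1) by simp
        also have "dist p q \<le> 2 * real R"
          using that(2,3) dist_triangle[of p q p\<^sub>0] by (simp add: dist_commute)
        then have "c ^ n * dist p q \<le> c ^ n * (2 * real R)"
          using c(1) by (intro mult_left_mono) auto
        also note n
        finally show ?thesis using that(4) by (auto simp: N_def)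
      qed
    qed (use R F in \<open>auto simp: N_def less_imp_le intro!: borel_open\<close>)
  qed
  interpret \<psi>: prob_space "\<psi> x"
    using sol(2) by (auto simp: is_solution_def borel_probs_def)
  have "sets (\<psi> x) = sets borel"
    using sol(2) by (auto simp: is_solution_def borel_probs_def)
  \<comment> \<open>The shift to \<open>Suc n\<close> keeps every radius positive, as
    \<open>le\<close> demands.\<close>
  then have "range (\<lambda>n. N (1 / real (Suc n))) \<subseteq> sets (\<psi> x)"
    by (auto simp: N_def intro!: borel_open)
  moreover have "decseq (\<lambda>n. N (1 / real (Suc n)))"
  proof (rule decseq_SucI)
    fix n
    have "1 / real (Suc (Suc n)) \<le> 1 / real (Suc n)" by (simp add: field_simps)
    then show "N (1 / real (Suc (Suc n))) \<subseteq> N (1 / real (Suc n))"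
      unfolding N_def by (intro UN_mono subset_ball) auto
  qed
  ultimately have "(\<lambda>n. measure (\<psi> x) (N (1 / real (Suc n)))) \<longlonglongrightarrow>
      measure (\<psi> x) (\<Inter>n. N (1 / real (Suc n)))"
    by (rule \<psi>.finite_Lim_measure_decseq)
  also have "(\<Inter>n. N (1 / real (Suc n))) = F"
  proof
    have "p \<in> closure F" if p: "\<And>n. p \<in> N (1 / real (Suc n))" for p
      unfolding closure_approachable
    proof (intro allI impI)
      fix e :: real assume "e > 0"
      then obtain n where "1 / real (Suc n) < e" using nat_approx_posE by blast
      then show "\<exists>q\<in>F. dist q p < e" using p[of n] by (force simp: N_def)
    qed
    then show "(\<Inter>n. N (1 / real (Suc n))) \<subseteq> F" using F by (auto simp: closure_closed)
    show "F \<subseteq> (\<Inter>n. N (1 / real (Suc n)))" by (force simp: N_def)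
  qed
  finally show ?thesis
    by (rule LIMSEQ_le_const) (use le in auto)
qed

text \<open>Swapping the two solutions turns the inequality on closed sets into equality. As both
  measures live on the Borel sets, agreement on this generator makes them equal.\<close>

lemma solution_unique:
  fixes \<beta> :: "('x::finite, 'a::finite) lmc"
    and \<sigma> :: "'a \<Rightarrow> 'm::metric_space \<Rightarrow> 'm"
  assumes \<sigma>: "\<And>a. \<sigma> a \<in> Con"
    and sol: "is_solution \<beta> \<sigma> \<phi>" "is_solution \<beta> \<sigma> \<psi>"
  shows "\<phi> = \<psi>"
proof
  fix x
  have prob: "prob_space (\<phi> x)" "prob_space (\<psi> x)"
    and sets: "sets (\<phi> x) = sigma_sets UNIV (Collect closed)"
      "sets (\<psi> x) = sigma_sets UNIV (Collect closed)"
    using sol by (auto simp: is_solution_def borel_probs_def borel_eq_closed)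
  show "\<phi> x = \<psi> x"
  proof (rule measure_eqI_generator_eq[OF _ _ _ sets])
    show "emeasure (\<phi> x) F = emeasure (\<psi> x) F" if "F \<in> Collect closed" for F
    proof -
      have "measure (\<phi> x) F = measure (\<psi> x) F"
        using that solution_le_solution[OF \<sigma> sol] solution_le_solution[OF \<sigma> sol(2,1)]
        by (intro antisym) auto
      then show ?thesis
        using prob by (simp add: finite_measure.emeasure_eq_measure prob_space.finite_measure)
    qed
    show "emeasure (\<phi> x) UNIV \<noteq> \<infinity>" for i :: nat
      using prob(1) by (simp add: finite_measure.emeasure_eq_measure prob_space.finite_measure)
  qed (auto simp: Int_stable_def)
qed

theorem mainTheorem9:
  fixes \<beta> :: "('x::finite, 'a::finite) lmc"
    and \<sigma> :: "'a \<Rightarrow> 'm::complete_space \<Rightarrow> 'm"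
  assumes "\<And>a. \<sigma> a \<in> Con"
  shows "is_solution \<beta> \<sigma> (subfractal_measure \<beta> \<sigma>) \<and>
         (\<forall>\<phi>. is_solution \<beta> \<sigma> \<phi> \<longrightarrow> \<phi> = subfractal_measure \<beta> \<sigma>)"
proof (intro conjI allI impI)
  show sol: "is_solution \<beta> \<sigma> (subfractal_measure \<beta> \<sigma>)"
    using assms by (rule is_solution_subfractal_measure)
  show "\<phi> = subfractal_measure \<beta> \<sigma>" if "is_solution \<beta> \<sigma> \<phi>" for \<phi>
    using assms that sol by (rule solution_unique)
qed

end
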